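(* Let $H=\begin{bmatrix} A & X\\ X & B\end{bmatrix}\in\mathbb{M}_{2n}^+$ be partitioned into Hermitian blocks $A,B,X\in\mathbb{M}_n$. Then $$\lambda_{1+2k}(H)\le\lambda_{1+k}(A+B)$$ for all $k=0,\ldots,n-1$.
   Context: $\mathbb{M}_n$ is the algebra of $n\times n$ matrices with real or complex entries (the statement holds for either choice), and $\mathbb{M}_m^+$ is the set of positive semidefinite (Hermitian) matrices in $\mathbb{M}_m$. For $T\in\mathbb{M}_m^+$, $\lambda_j(T)$ denotes the $j$th eigenvalue of $T$ in decreasing order, counted with multiplicity, with the convention $\lambda_j(T)=0$ for $j>m$. *)

theory Defs
  imports
    "HOL-Library.Multiset"
    "HOL-Computational_Algebra.Polynomial"
    "Jordan_Normal_Form.Char_Poly"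
    "Jordan_Normal_Form.Schur_Decomposition"
begin

(* The definitions below are used for 'a = real (conjugate = identity) and
   'a = complex (conjugate = cnj). *)

definition hermitian_mat :: "'a :: conjugatable_field mat \<Rightarrow> bool" where
  "hermitian_mat T \<longleftrightarrow> mat_adjoint T = T"

(* Over complex, 0 \<le> z is the order of Complex_Order: z is real and nonnegative. *)
definition psd_mat :: "'a :: conjugatable_ordered_field mat \<Rightarrow> bool" where
  "psd_mat T \<longleftrightarrow> hermitian_mat T \<and>
     (\<forall>v \<in> carrier_vec (dim_row T). 0 \<le> (T *\<^sub>v v) \<bullet>c v)"

(* The j-th largest element, counting from j = 1 and with multiplicity;
   0 when there is no such element. *)
definition nth_largest :: "real multiset \<Rightarrow> nat \<Rightarrow> real" where
  "nth_largest M j =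
     (if 1 \<le> j \<and> j \<le> size M then rev (sorted_list_of_multiset M) ! (j - 1) else 0)"

(* For a Hermitian m x m matrix all roots of the characteristic polynomial are real and
   there are m of them with multiplicity, so for j > m the value is 0.  For such a matrix
   Re below discards nothing: it is only the passage from type complex to type real. *)
definition eig_real :: "nat \<Rightarrow> real mat \<Rightarrow> real" where
  "eig_real j T = nth_largest (proots (char_poly T)) j"

definition eig_complex :: "nat \<Rightarrow> complex mat \<Rightarrow> real" where
  "eig_complex j T = nth_largest (image_mset Re (proots (char_poly T))) j"

end

theory Submission
  imports Defs
begin

text \<open>
  Put \<open>S = A + B\<close> and \<open>J = [[0, I], [-I, 0]]\<close>. Since \<open>J H J\<^sup>* = [[B, -X], [-X, A]]\<close>, the matrices
  \<open>H\<close> and \<open>J H J\<^sup>*\<close> add up to the block diagonal matrix \<open>S \<oplus> S\<close>. The second summand is positive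
  semidefinite together with \<open>H\<close>, so \<open>H \<le> S \<oplus> S\<close> as quadratic forms (\<open>psd_block_form_le\<close>). Ordered
  eigenvalues are monotone in the form (\<open>eig_complex_mono\<close>), and those of \<open>S \<oplus> S\<close> are the ones of \<open>S\<close>,
  each listed twice (\<open>eig_complex_block_diagonal\<close>), whence
  \<open>\<lambda>\<^bsub>1+2k\<^esub>(H) \<le> \<lambda>\<^bsub>1+2k\<^esub>(S \<oplus> S) = \<lambda>\<^bsub>1+k\<^esub>(S)\<close>.

  Monotonicity rests on the unitary diagonalization of Hermitian matrices
  (\<open>hermitian_unitary_diagonalization\<close>). It is carried out over the complex numbers, where the
  characteristic polynomial splits. The real case follows by reading real matrices as complex ones,
  which preserves positive semidefiniteness (\<open>psd_mat_complexify\<close>) and the ordered eigenvalues of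
  symmetric matrices (\<open>eig_real_eq_eig_complex\<close>).
\<close>

section \<open>Adjoints and Hermitian matrices\<close>

lemma mat_adjoint_carrier: "A \<in> carrier_mat m n \<Longrightarrow> mat_adjoint A \<in> carrier_mat n m"
  unfolding mat_adjoint_def by auto

lemma mat_adjoint_index:
  assumes "A \<in> carrier_mat m n" "i < n" "j < m"
  shows "mat_adjoint A $$ (i, j) = conjugate (A $$ (j, i))"
  using assms by (simp add: mat_adjoint_def mat_of_rows_def)

lemma mat_adjoint_mult:
  assumes A: "A \<in> carrier_mat l m" and B: "B \<in> carrier_mat m n"
  shows "mat_adjoint (A * B) = mat_adjoint B * mat_adjoint A"
proof (rule eq_matI)
  note adj = mat_adjoint_carrier[OF A] mat_adjoint_carrier[OF B]
    mat_adjoint_carrier[OF mult_carrier_mat[OF A B]]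
  show "dim_row (mat_adjoint (A * B)) = dim_row (mat_adjoint B * mat_adjoint A)"
    "dim_col (mat_adjoint (A * B)) = dim_col (mat_adjoint B * mat_adjoint A)"
    using adj by auto
  fix i j
  assume "i < dim_row (mat_adjoint B * mat_adjoint A)"
    and "j < dim_col (mat_adjoint B * mat_adjoint A)"
  hence i: "i < n" and j: "j < l" using adj by auto
  have "mat_adjoint (A * B) $$ (i, j) = (\<Sum>k<m. conjugate (A $$ (j, k) * B $$ (k, i)))"
    unfolding mat_adjoint_index[OF mult_carrier_mat[OF A B] i j]
    using A B i j by (simp add: scalar_prod_def sum_conjugate atLeast0LessThan)
  also have "\<dots> = (\<Sum>k<m. mat_adjoint B $$ (i, k) * mat_adjoint A $$ (k, j))"
    by (rule sum.cong, auto simp: mat_adjoint_index[OF A _ j] mat_adjoint_index[OF B i]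
        conjugate_dist_mul mult.commute)
  also have "\<dots> = (mat_adjoint B * mat_adjoint A) $$ (i, j)"
    using adj i j by (simp add: scalar_prod_def atLeast0LessThan)
  finally show "mat_adjoint (A * B) $$ (i, j) = (mat_adjoint B * mat_adjoint A) $$ (i, j)" .
qed

lemma mat_adjoint_adjoint: "mat_adjoint (mat_adjoint A) = A"
  using mat_adjoint_carrier[of A "dim_row A" "dim_col A"]
    mat_adjoint_carrier[of "mat_adjoint A" "dim_col A" "dim_row A"]
  by (intro eq_matI) (auto simp: mat_adjoint_index[of _ "dim_col A" "dim_row A"]
      mat_adjoint_index[of _ "dim_row A" "dim_col A"])

lemma cscalar_prod_mult_adjoint:
  assumes A: "A \<in> carrier_mat m n" and v: "v \<in> carrier_vec n" and w: "w \<in> carrier_vec m"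
  shows "(A *\<^sub>v v) \<bullet>c w = v \<bullet>c (mat_adjoint A *\<^sub>v w)"
proof -
  note adj = mat_adjoint_carrier[OF A]
  have "(A *\<^sub>v v) \<bullet>c w = (\<Sum>i<m. \<Sum>j<n. A $$ (i, j) * v $ j * conjugate (w $ i))"
    using A v w by (simp add: scalar_prod_def sum_distrib_right atLeast0LessThan)
  also have "\<dots> = (\<Sum>j<n. \<Sum>i<m. A $$ (i, j) * v $ j * conjugate (w $ i))"
    by (rule sum.swap)
  also have "\<dots> = v \<bullet>c (mat_adjoint A *\<^sub>v w)"
    using adj v w by (simp add: scalar_prod_def sum_distrib_left atLeast0LessThan sum_conjugate
        conjugate_dist_mul mat_adjoint_index[OF A] mult_ac)
  finally show ?thesis .
qed

lemma hermitian_mat_index: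
  assumes "hermitian_mat A" "A \<in> carrier_mat n n" "i < n" "j < n"
  shows "conjugate (A $$ (j, i)) = A $$ (i, j)"
  using assms mat_adjoint_index[of A n n i j] by (simp add: hermitian_mat_def)

lemma hermitian_matI:
  assumes A: "A \<in> carrier_mat n n"
    and "\<And>i j. i < n \<Longrightarrow> j < n \<Longrightarrow> conjugate (A $$ (j, i)) = A $$ (i, j)"
  shows "hermitian_mat A"
  unfolding hermitian_mat_def using mat_adjoint_carrier[OF A] assms
  by (intro eq_matI) (auto simp: mat_adjoint_index[OF A])

lemma hermitian_mat_congruence:
  assumes A: "A \<in> carrier_mat n n" "hermitian_mat A" and U: "U \<in> carrier_mat n m"
  shows "hermitian_mat (mat_adjoint U * A * U)"
proof -
  note U' = mat_adjoint_carrier[OF U]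
  show ?thesis
    unfolding hermitian_mat_def mat_adjoint_mult[OF mult_carrier_mat[OF U' A(1)] U]
      mat_adjoint_mult[OF U' A(1)] mat_adjoint_adjoint A(2)[unfolded hermitian_mat_def]
    by (rule assoc_mult_mat[OF U' A(1) U, symmetric])
qed

lemma hermitian_mat_add:
  assumes "A \<in> carrier_mat n n" "hermitian_mat A" "B \<in> carrier_mat n n" "hermitian_mat B"
  shows "hermitian_mat (A + B)"
  using assms hermitian_mat_index[OF assms(2,1)] hermitian_mat_index[OF assms(4,3)]
  by (intro hermitian_matI[of _ n]) (auto simp: conjugate_dist_add)

lemma hermitian_block_diagonal:
  assumes "S \<in> carrier_mat n n" "hermitian_mat S"
  shows "hermitian_mat (four_block_mat S (0\<^sub>m n n) (0\<^sub>m n n) S)"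
  using assms(1) hermitian_mat_index[OF assms(2,1)]
  by (intro hermitian_matI[of _ "n + n"]) auto

section \<open>Unitary diagonalization\<close>

lemma cscalar_prod_self_complex:
  fixes v :: "complex vec"
  assumes "v \<in> carrier_vec n"
  shows "v \<bullet>c v = of_real (\<Sum>i<n. (cmod (v $ i))\<^sup>2)"
  using assms by (simp add: scalar_prod_def atLeast0LessThan complex_norm_square[symmetric])

lemma mat_adjoint_mult_index:
  assumes "W \<in> carrier_mat m n" "A \<in> carrier_mat m l" "i < n" "j < l"
  shows "(mat_adjoint W * A) $$ (i, j) = col A j \<bullet>c col W i"
  using assms mat_adjoint_carrier[OF assms(1)]
  by (simp add: scalar_prod_def mat_adjoint_index[OF assms(1)] mult.commute)

text \<open>Completing \<open>v\<close> to a basis and applying Gram-Schmidt gives orthogonal columns beginning with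
  \<open>v\<close>; it remains to normalize them.\<close>

lemma unitary_with_first_column:
  fixes v :: "complex vec"
  assumes v: "v \<in> carrier_vec n" and v0: "v \<noteq> 0\<^sub>v n"
  obtains W c where "W \<in> carrier_mat n n" "mat_adjoint W * W = 1\<^sub>m n" "col W 0 = c \<cdot>\<^sub>v v"
proof -
  interpret cof_vec_space n "TYPE(complex)" .
  define ws where "ws = gram_schmidt n (basis_completion v)"
  note bc = basis_completion[OF v v0]
  note gs = gram_schmidt_result[OF bc(2) bc(4) bc(5) ws_def]
  have len: "length ws = n" using gs(4) bc(6) by simp
  have n: "n > 0" using v v0 by (cases n) auto
  obtain vs where "basis_completion v = v # vs"
    using bc(6,7) n by (cases "basis_completion v") auto
  hence "hd ws = v" using gram_schmidt_hd[OF v, of vs] by (simp add: ws_def)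
  hence hd: "ws ! 0 = v" using hd_conv_nth[of ws] len n by (cases ws) auto
  have wsc: "ws ! i \<in> carrier_vec n" if "i < n" for i using gs(3) len that by auto
  define nrm where "nrm i = complex_of_real (sqrt (\<Sum>l<n. (cmod (ws ! i $ l))\<^sup>2))" for i
  have self: "ws ! i \<bullet>c ws ! i = nrm i * nrm i" if "i < n" for i
    unfolding cscalar_prod_self_complex[OF wsc[OF that]] nrm_def of_real_mult[symmetric]
    by (simp add: sum_nonneg)
  define W where "W = mat_of_cols n (map (\<lambda>i. inverse (nrm i) \<cdot>\<^sub>v ws ! i) [0..<n])"
  have W: "W \<in> carrier_mat n n" unfolding W_def by auto
  have colW: "col W i = inverse (nrm i) \<cdot>\<^sub>v ws ! i" if "i < n" for i
    unfolding W_def using that wsc[OF that] by (subst col_mat_of_cols) auto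
  have "mat_adjoint W * W = 1\<^sub>m n"
  proof (rule eq_matI)
    fix i j assume "i < dim_row (1\<^sub>m n :: complex mat)" "j < dim_col (1\<^sub>m n :: complex mat)"
    hence i: "i < n" and j: "j < n" by auto
    have "(mat_adjoint W * W) $$ (i, j) = inverse (nrm j) * inverse (nrm i) * (ws ! j \<bullet>c ws ! i)"
      unfolding mat_adjoint_mult_index[OF W W i j] colW[OF i] colW[OF j]
      using wsc[OF i] wsc[OF j] by (simp add: conjugate_smult_vec nrm_def)
    also have "\<dots> = (if i = j then 1 else 0)"
      using corthogonalD[OF gs(2), of j i] self[OF i] i j len by (auto simp: field_simps)
    finally show "(mat_adjoint W * W) $$ (i, j) = 1\<^sub>m n $$ (i, j)" using i j by simp
  qed (use W mat_adjoint_carrier[OF W] in auto)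
  thus thesis using that[OF W] colW[OF n] hd by auto
qed

text \<open>The spectral theorem by deflation: conjugating with a unitary matrix whose first column is an
  eigenvector for \<open>e\<close> produces a Hermitian matrix whose first column is \<open>(e, 0, \<dots>, 0)\<close>. Being
  Hermitian, it has the same first row up to conjugation, so it splits as \<open>e \<oplus> A3\<close> and the
  induction continues with \<open>A3\<close>. The enumeration \<open>es\<close> of the eigenvalues is prescribed, so that a
  sorted one can be chosen later.\<close>

lemma hermitian_unitary_diagonalization:
  fixes A :: "complex mat"
  assumes "A \<in> carrier_mat n n" "hermitian_mat A" "char_poly A = (\<Prod>e\<leftarrow>es. [:- e, 1:])"
  shows "\<exists>U \<in> carrier_mat n n. mat_adjoint U * U = 1\<^sub>m n \<and>
    mat_adjoint U * A * U = mat_diag n (\<lambda>i. es ! i)"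
  using assms
proof (induction es arbitrary: n A)
  case Nil
  with degree_monic_char_poly[OF Nil(1)] have "n = 0" by simp
  thus ?case using Nil by (intro bexI[of _ "1\<^sub>m 0"]) (auto intro!: eq_matI simp: mat_adjoint_def mat_diag_def)
next
  case (Cons e es)
  note A = Cons.prems(1) and herm = Cons.prems(2)
  have "length (e # es) = n"
    using degree_monic_char_poly[OF A] degree_linear_factors[of uminus "e # es"] Cons.prems(3)
    by simp
  then obtain m where n: "n = Suc m" by (cases n) auto
  have "eigenvalue A e"
    unfolding eigenvalue_root_char_poly[OF A] Cons.prems(3) by simp
  then obtain v where v: "v \<in> carrier_vec n" "v \<noteq> 0\<^sub>v n" and Av: "A *\<^sub>v v = e \<cdot>\<^sub>v v"
    using A unfolding eigenvalue_def eigenvector_def by auto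
  obtain W c where W: "W \<in> carrier_mat n n" and WW: "mat_adjoint W * W = 1\<^sub>m n"
    and W0: "col W 0 = c \<cdot>\<^sub>v v" using unitary_with_first_column[OF v] .
  note W' = mat_adjoint_carrier[OF W]
  have WW': "W * mat_adjoint W = 1\<^sub>m n" using mat_mult_left_right_inverse[OF W' W WW] .
  define A' where "A' = mat_adjoint W * A * W"
  have A': "A' \<in> carrier_mat n n" unfolding A'_def using W W' A by auto
  have herm': "hermitian_mat A'" unfolding A'_def by (rule hermitian_mat_congruence[OF A herm W])
  have colAW: "col (A * W) 0 = e \<cdot>\<^sub>v col W 0"
  proof -
    have "col (A * W) 0 = A *\<^sub>v col W 0" using A W n by (intro col_mult2) auto
    thus ?thesis unfolding W0 using A v Av by (simp add: mult_mat_vec smult_smult_assoc mult.commute)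
  qed
  have A'0: "A' $$ (i, 0) = (if i = 0 then e else 0)" if i: "i < n" for i
  proof -
    have "A' $$ (i, 0) = (mat_adjoint W * (A * W)) $$ (i, 0)"
      unfolding A'_def using W W' A by simp
    also have "\<dots> = e * (col W 0 \<bullet>c col W i)"
      using mat_adjoint_mult_index[OF W _ i, of "A * W" n 0] A W n colAW by simp
    also have "\<dots> = e * (mat_adjoint W * W) $$ (i, 0)"
      using mat_adjoint_mult_index[OF W W i, of 0] n by simp
    finally show ?thesis unfolding WW using i n by simp
  qed
  have A'0': "A' $$ (0, j) = 0" if "j < n" "j \<noteq> 0" for j
    using hermitian_mat_index[OF herm' A', of 0 j] A'0[of j] that n by simp
  define A3 where "A3 = mat m m (\<lambda>(i, j). A' $$ (Suc i, Suc j))"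
  define A1 where "A1 = mat 1 1 (\<lambda>_. e)"
  have A3: "A3 \<in> carrier_mat m m" unfolding A3_def by auto
  have A1: "A1 \<in> carrier_mat 1 1" unfolding A1_def by auto
  have block: "A' = four_block_mat A1 (0\<^sub>m 1 m) (0\<^sub>m m 1) A3"
    using A' n A'0 A'0' by (intro eq_matI) (auto simp: A1_def A3_def)
  have herm3: "hermitian_mat A3"
    using hermitian_mat_index[OF herm' A'] n by (intro hermitian_matI[OF A3]) (auto simp: A3_def)
  have "similar_mat_wit A' A (mat_adjoint W) W"
    by (rule similar_mat_witI[OF WW WW' A'_def A' A W' W])
  hence "char_poly A' = char_poly A" by (intro char_poly_similar) (auto simp: similar_mat_def)
  moreover have "char_poly A' = char_poly A1 * char_poly A3"
    unfolding block by (rule char_poly_four_block_zeros_col[OF A1 _ A3]) auto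
  moreover have "char_poly A1 = [:- e, 1:]"
    by (simp add: A1_def char_poly_defs det_def sign_def)
  ultimately have "[:- e, 1:] * char_poly A3 = [:- e, 1:] * (\<Prod>e\<leftarrow>es. [:- e, 1:])"
    using Cons.prems(3) by simp
  hence "char_poly A3 = (\<Prod>e\<leftarrow>es. [:- e, 1:])"
    by (metis mult_cancel_left pCons_eq_0_iff zero_neq_one)
  from Cons.IH[OF A3 herm3 this] obtain P where P: "P \<in> carrier_mat m m"
    and PP: "mat_adjoint P * P = 1\<^sub>m m" and PA: "mat_adjoint P * A3 * P = mat_diag m (\<lambda>i. es ! i)"
    by auto
  note P' = mat_adjoint_carrier[OF P]
  define Q where "Q = four_block_mat (1\<^sub>m 1) (0\<^sub>m 1 m) (0\<^sub>m m 1) P"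
  have Q: "Q \<in> carrier_mat n n" unfolding Q_def n using P by auto
  note Q' = mat_adjoint_carrier[OF Q]
  have adjQ: "mat_adjoint Q = four_block_mat (1\<^sub>m 1) (0\<^sub>m 1 m) (0\<^sub>m m 1) (mat_adjoint P)"
  proof (rule eq_matI)
    fix i j
    assume "i < dim_row (four_block_mat (1\<^sub>m 1) (0\<^sub>m 1 m) (0\<^sub>m m 1) (mat_adjoint P))"
      "j < dim_col (four_block_mat (1\<^sub>m 1) (0\<^sub>m 1 m) (0\<^sub>m m 1) (mat_adjoint P))"
    hence i: "i < n" and j: "j < n" using P' n by auto
    show "mat_adjoint Q $$ (i, j) =
      four_block_mat (1\<^sub>m 1) (0\<^sub>m 1 m) (0\<^sub>m m 1) (mat_adjoint P) $$ (i, j)"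
      unfolding mat_adjoint_index[OF Q i j] using i j P P' n
      by (auto simp: Q_def mat_adjoint_index[OF P])
  qed (use Q' P' n in auto)
  have QQ: "mat_adjoint Q * Q = 1\<^sub>m n"
    unfolding adjQ unfolding Q_def
    by (subst mult_four_block_mat[of _ 1 1 _ m _ m _ _ 1 _ m], use P P' PP n in auto)
  have QAQ: "mat_adjoint Q * A' * Q = mat_diag n (\<lambda>i. (e # es) ! i)"
  proof -
    have "mat_adjoint Q * A' * Q = four_block_mat A1 (0\<^sub>m 1 m) (0\<^sub>m m 1) (mat_adjoint P * A3 * P)"
      unfolding adjQ block unfolding Q_def
      apply (subst mult_four_block_mat[of _ 1 1 _ m _ m _ _ 1 _ m], use P P' A1 A3 in auto)
      by (subst mult_four_block_mat[of _ 1 1 _ m _ m _ _ 1 _ m], use P P' A1 A3 in auto)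
    also have "\<dots> = mat_diag n (\<lambda>i. (e # es) ! i)"
      unfolding PA by (rule eq_matI) (auto simp: mat_diag_def A1_def n nth_Cons')
    finally show ?thesis .
  qed
  have adjWQ: "mat_adjoint (W * Q) = mat_adjoint Q * mat_adjoint W"
    by (rule mat_adjoint_mult[OF W Q])
  have "mat_adjoint (W * Q) * (W * Q) = mat_adjoint Q * (mat_adjoint W * W) * Q"
    unfolding adjWQ using W Q W' Q' by (simp add: assoc_mult_mat[of _ n n _ n _ n])
  also have "\<dots> = 1\<^sub>m n" unfolding WW using QQ Q' by simp
  finally have 1: "mat_adjoint (W * Q) * (W * Q) = 1\<^sub>m n" .
  have "mat_adjoint (W * Q) * A * (W * Q) = mat_adjoint Q * A' * Q"
    unfolding adjWQ A'_def using W Q W' Q' A by (simp add: assoc_mult_mat[of _ n n _ n _ n])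
  with QAQ 1 show ?case using W Q by (intro bexI[of _ "W * Q"]) auto
qed


section \<open>Eigenvalues in decreasing order\<close>

lemma nth_largest_mset_descending:
  assumes "sorted_wrt (\<ge>) rs" "j < length rs"
  shows "nth_largest (mset rs) (Suc j) = rs ! j"
proof -
  have "sort rs = rev rs"
    using assms(1) by (intro properties_for_sort) (auto simp: sorted_wrt_rev)
  thus ?thesis using assms(2) by (simp add: nth_largest_def)
qed

lemma descending_list_exists:
  obtains rs where "mset rs = M" "sorted_wrt (\<ge>) (rs :: real list)"
  using that[of "rev (sorted_list_of_multiset M)"] by (simp add: sorted_wrt_rev)

lemma nth_largest_double:
  "nth_largest (M + M) (1 + 2 * k) = nth_largest M (1 + k)"
proof -
  obtain rs where rs: "mset rs = M" "sorted_wrt (\<ge>) rs" by (rule descending_list_exists)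
  (* Repeating every entry of a descending list of M in place gives a descending list of M + M. *)
  define ds where "ds = concat (map (\<lambda>r. [r, r]) rs)"
  have mset: "mset ds = M + M" unfolding rs(1)[symmetric] ds_def by (induction rs) auto
  have len: "length ds = 2 * length rs" unfolding ds_def by (induction rs) auto
  have sorted: "sorted_wrt (\<ge>) ds"
    using rs(2) unfolding ds_def by (induction rs) (auto simp: sorted_wrt_append)
  have nth: "k < length rs \<Longrightarrow> ds ! (2 * k) = rs ! k" for k
    unfolding ds_def
  proof (induction rs arbitrary: k)
    case (Cons r rs)
    thus ?case by (cases k) auto
  qed simp
  show ?thesis
  proof (cases "k < length rs")
    case True
    thus ?thesis
      using nth_largest_mset_descending[OF sorted, of "2 * k"]
        nth_largest_mset_descending[OF rs(2), of k] nth[of k] len by (simp add: mset rs(1))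
  next
    case False
    thus ?thesis using rs(1) by (auto simp: nth_largest_def)
  qed
qed

lemma proots_linear_factors: "proots (\<Prod>a\<leftarrow>as. [:- a, 1:]) = mset (as :: 'a :: idom list)"
proof (induction as)
  case (Cons a as)
  have "(\<Prod>a\<leftarrow>as. [:- a, 1:]) \<noteq> 0" by (auto simp: prod_list_zero_iff)
  thus ?case using Cons by (simp add: proots_mult del: mult_pCons_left)
qed simp

lemma eig_complex_linear_factors:
  assumes "char_poly M = (\<Prod>r\<leftarrow>rs. [:- complex_of_real r, 1:])"
  shows "eig_complex j M = nth_largest (mset rs) j"
proof -
  have "proots (char_poly M) = mset (map complex_of_real rs)"
    using proots_linear_factors[of "map complex_of_real rs"] by (simp add: assms comp_def)
  thus ?thesis by (simp add: eig_complex_def image_mset.compositionality comp_def)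
qed

section \<open>Monotonicity of the ordered eigenvalues\<close>

lemma mat_diag_mult_vec:
  assumes "v \<in> carrier_vec n"
  shows "mat_diag n f *\<^sub>v v = vec n (\<lambda>i. f i * v $ i)"
proof (rule eq_vecI)
  fix i assume "i < dim_vec (vec n (\<lambda>i. f i * v $ i))"
  hence i: "i < n" by simp
  have "(mat_diag n f *\<^sub>v v) $ i = (\<Sum>j<n. (if i = j then f j else 0) * v $ j)"
    using assms i by (simp add: mat_diag_def scalar_prod_def atLeast0LessThan)
  also have "\<dots> = (\<Sum>j<n. if i = j then f j * v $ j else 0)" by (rule sum.cong) auto
  also have "\<dots> = f i * v $ i" using i by simp
  finally show "(mat_diag n f *\<^sub>v v) $ i = vec n (\<lambda>i. f i * v $ i) $ i" using i by simp
qed (simp add: mat_diag_def)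

text \<open>The spectral theorem in the form needed for comparing two matrices: \<open>V\<close> sends a vector to its
  coordinates in an orthonormal eigenbasis, listed by decreasing eigenvalue.\<close>

lemma hermitian_form_eigencoordinates:
  fixes M :: "complex mat"
  assumes M: "M \<in> carrier_mat n n" and herm: "hermitian_mat M"
  obtains rs V where "length rs = n" "sorted_wrt (\<ge>) rs"
    "char_poly M = (\<Prod>r\<leftarrow>rs. [:- complex_of_real r, 1:])" "V \<in> carrier_mat n n"
    "\<forall>v \<in> carrier_vec n. v \<bullet>c v = of_real (\<Sum>i<n. (cmod ((V *\<^sub>v v) $ i))\<^sup>2)"
    "\<forall>v \<in> carrier_vec n.
       (M *\<^sub>v v) \<bullet>c v = of_real (\<Sum>i<n. rs ! i * (cmod ((V *\<^sub>v v) $ i))\<^sup>2)"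
proof -
  obtain es where es: "char_poly M = (\<Prod>e\<leftarrow>es. [:- e, 1:])" and len: "length es = n"
    using char_poly_factorized[OF M] by auto
  (* The diagonal matrix is unitarily congruent to M, hence Hermitian, so its entries are real. *)
  have real: "complex_of_real (Re e) = e" if "e \<in> set es" for e
  proof -
    from that len obtain i where i: "i < n" "es ! i = e" by (auto simp: in_set_conv_nth)
    obtain U where U: "U \<in> carrier_mat n n" and D: "mat_adjoint U * M * U = mat_diag n (\<lambda>i. es ! i)"
      using hermitian_unitary_diagonalization[OF M herm es] by auto
    have "hermitian_mat (mat_diag n (\<lambda>i. es ! i))"
      unfolding D[symmetric] by (rule hermitian_mat_congruence[OF M herm U])
    from hermitian_mat_index[OF this _ i(1) i(1)] i show ?thesis
      by (simp add: mat_diag_def complex_eq_iff)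
  qed
  define rs where "rs = rev (sort (map Re es))"
  have rs: "length rs = n" "sorted_wrt (\<ge>) rs"
    unfolding rs_def using len by (auto simp: sorted_wrt_rev)
  have "mset (map complex_of_real rs) = mset (map (\<lambda>e. complex_of_real (Re e)) es)"
    by (simp add: rs_def image_mset.compositionality comp_def)
  also have "map (\<lambda>e. complex_of_real (Re e)) es = es" using real by (simp add: map_idI)
  finally have "mset (map (\<lambda>e. [:- e, 1:]) es) = mset (map (\<lambda>r. [:- complex_of_real r, 1:]) rs)"
    by (metis (no_types, lifting) mset_map map_map comp_apply map_eq_conv)
  hence cp: "char_poly M = (\<Prod>r\<leftarrow>rs. [:- complex_of_real r, 1:])"
    unfolding es by (metis prod_mset_prod_list)
  hence cp': "char_poly M = (\<Prod>e\<leftarrow>map complex_of_real rs. [:- e, 1:])" by (simp add: comp_def)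
  obtain U where U: "U \<in> carrier_mat n n" and UU: "mat_adjoint U * U = 1\<^sub>m n"
    and D: "mat_adjoint U * M * U = mat_diag n (\<lambda>i. map complex_of_real rs ! i)"
    using hermitian_unitary_diagonalization[OF M herm cp'] by auto
  note U' = mat_adjoint_carrier[OF U]
  have UU': "U * mat_adjoint U = 1\<^sub>m n" by (rule mat_mult_left_right_inverse[OF U' U UU])
  define V where "V = mat_adjoint U"
  note V = U'[folded V_def]
  have recover: "U *\<^sub>v (V *\<^sub>v v) = v" if "v \<in> carrier_vec n" for v
    using that V U UU' by (simp add: V_def flip: assoc_mult_mat_vec)
  have diag_form: "vec n (\<lambda>i. of_real (rs ! i) * c $ i) \<bullet>c c
      = of_real (\<Sum>i<n. rs ! i * (cmod (c $ i))\<^sup>2)" if "c \<in> carrier_vec n" for c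
    using that by (simp add: scalar_prod_def atLeast0LessThan mult.assoc complex_norm_square[symmetric])
  show thesis
  proof (rule that[OF rs cp V], safe)
    fix v :: "complex vec" assume v: "v \<in> carrier_vec n"
    have Vv: "V *\<^sub>v v \<in> carrier_vec n" using V v by auto
    have "v \<bullet>c v = (U *\<^sub>v (V *\<^sub>v v)) \<bullet>c v" by (simp add: recover[OF v])
    also have "\<dots> = (V *\<^sub>v v) \<bullet>c (V *\<^sub>v v)"
      using cscalar_prod_mult_adjoint[OF U Vv v] by (simp only: V_def)
    finally show "v \<bullet>c v = of_real (\<Sum>i<n. (cmod ((V *\<^sub>v v) $ i))\<^sup>2)"
      unfolding cscalar_prod_self_complex[OF Vv] .
    have MU: "M *\<^sub>v (U *\<^sub>v (V *\<^sub>v v)) \<in> carrier_vec n" using M U Vv by auto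
    have "(M *\<^sub>v v) \<bullet>c v = (M *\<^sub>v (U *\<^sub>v (V *\<^sub>v v))) \<bullet>c (U *\<^sub>v (V *\<^sub>v v))"
      by (simp add: recover[OF v])
    also have "\<dots> = (V *\<^sub>v (M *\<^sub>v (U *\<^sub>v (V *\<^sub>v v)))) \<bullet>c (V *\<^sub>v v)"
      using cscalar_prod_mult_adjoint[OF V MU Vv] by (simp add: V_def mat_adjoint_adjoint)
    also have "V *\<^sub>v (M *\<^sub>v (U *\<^sub>v (V *\<^sub>v v))) = (V * M * U) *\<^sub>v (V *\<^sub>v v)"
      using V M U Vv by (simp add: assoc_mult_mat_vec[of _ n n _ n])
    also have "\<dots> = vec n (\<lambda>i. of_real (rs ! i) * (V *\<^sub>v v) $ i)"
      unfolding D[folded V_def] mat_diag_mult_vec[OF Vv] using rs(1) by (intro eq_vecI) auto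
    also have "\<dots> \<bullet>c (V *\<^sub>v v) = of_real (\<Sum>i<n. rs ! i * (cmod ((V *\<^sub>v v) $ i))\<^sup>2)"
      by (rule diag_form[OF Vv])
    finally show "(M *\<^sub>v v) \<bullet>c v = of_real (\<Sum>i<n. rs ! i * (cmod ((V *\<^sub>v v) $ i))\<^sup>2)" .
  qed
qed

text \<open>Weyl's monotonicity principle, by the dimension count of Courant and Fischer. Let \<open>j = k + 1\<close>.
  The vectors orthogonal to the first \<open>k\<close> eigenvectors of \<open>N\<close> and to the last \<open>m - k - 1\<close>
  eigenvectors of \<open>M\<close> satisfy only \<open>m - 1\<close> linear conditions, so one of them is nonzero. On it the
  form of \<open>M\<close> is at least \<open>\<lambda>\<^sub>j(M)\<close> and the form of \<open>N\<close> at most \<open>\<lambda>\<^sub>j(N)\<close>, relative to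
  the squared norm.\<close>

lemma eig_complex_mono:
  fixes M N :: "complex mat"
  assumes M: "M \<in> carrier_mat m m" "hermitian_mat M"
    and N: "N \<in> carrier_mat m m" "hermitian_mat N"
    and le: "\<And>v. v \<in> carrier_vec m \<Longrightarrow> (M *\<^sub>v v) \<bullet>c v \<le> (N *\<^sub>v v) \<bullet>c v"
  shows "eig_complex j M \<le> eig_complex j N"
proof -
  obtain a P where a: "length a = m" "sorted_wrt (\<ge>) a"
    "char_poly M = (\<Prod>r\<leftarrow>a. [:- complex_of_real r, 1:])" and P: "P \<in> carrier_mat m m"
    "\<forall>v \<in> carrier_vec m. v \<bullet>c v = of_real (\<Sum>i<m. (cmod ((P *\<^sub>v v) $ i))\<^sup>2)"
    "\<forall>v \<in> carrier_vec m.
       (M *\<^sub>v v) \<bullet>c v = of_real (\<Sum>i<m. a ! i * (cmod ((P *\<^sub>v v) $ i))\<^sup>2)"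
    by (rule hermitian_form_eigencoordinates[OF M]) blast
  obtain b Q where b: "length b = m" "sorted_wrt (\<ge>) b"
    "char_poly N = (\<Prod>r\<leftarrow>b. [:- complex_of_real r, 1:])" and Q: "Q \<in> carrier_mat m m"
    "\<forall>v \<in> carrier_vec m. v \<bullet>c v = of_real (\<Sum>i<m. (cmod ((Q *\<^sub>v v) $ i))\<^sup>2)"
    "\<forall>v \<in> carrier_vec m.
       (N *\<^sub>v v) \<bullet>c v = of_real (\<Sum>i<m. b ! i * (cmod ((Q *\<^sub>v v) $ i))\<^sup>2)"
    by (rule hermitian_form_eigencoordinates[OF N]) blast
  note eig = eig_complex_linear_factors[OF a(3)] eig_complex_linear_factors[OF b(3)]
  show ?thesis
  proof (cases "1 \<le> j \<and> j \<le> m")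
    case False
    thus ?thesis unfolding eig using a(1) b(1) by (auto simp: nth_largest_def)
  next
    case True
    then obtain k where j: "j = Suc k" and k: "k < m" by (cases j) auto
    (* The conditions are the rows of a square matrix; row k is vacant and forces a kernel. *)
    define R where "R = mat m m (\<lambda>(i, l). if i < k then Q $$ (i, l)
      else if i = k then 0 else P $$ (i, l))"
    have R: "R \<in> carrier_mat m m" unfolding R_def by auto
    have "det R = 0"
      unfolding laplace_expansion_row[OF R k] by (rule sum.neutral) (use k in \<open>auto simp: R_def\<close>)
    then obtain v where v: "v \<in> carrier_vec m" "v \<noteq> 0\<^sub>v m" and Rv: "R *\<^sub>v v = 0\<^sub>v m"
      unfolding det_0_iff_vec_prod_zero[OF R] by auto
    have "(R *\<^sub>v v) $ i = (Q *\<^sub>v v) $ i" if "i < k" for i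
      using that k R Q(1) v by (auto simp: R_def scalar_prod_def intro!: sum.cong)
    hence Q0: "(Q *\<^sub>v v) $ i = 0" if "i < k" for i using that k Rv by simp
    have "(R *\<^sub>v v) $ i = (P *\<^sub>v v) $ i" if "k < i" "i < m" for i
      using that k R P(1) v by (auto simp: R_def scalar_prod_def intro!: sum.cong)
    hence P0: "(P *\<^sub>v v) $ i = 0" if "k < i" "i < m" for i using that Rv by simp
    define s where "s = (\<Sum>i<m. (cmod (v $ i))\<^sup>2)"
    have s: "v \<bullet>c v = of_real s" unfolding s_def by (rule cscalar_prod_self_complex[OF v(1)])
    hence "s > 0"
      using conjugate_square_greater_0_vec[OF v(1)] v(2) by (simp add: less_complex_def)
    have desc: "xs ! i \<ge> xs ! l" if "sorted_wrt (\<ge>) xs" "i \<le> l" "l < length xs" for xs :: "real list" and i l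
      using that sorted_wrt_nth_less[of "(\<ge>)" xs i l] by (cases "i = l") auto
    have "a ! k * s = (\<Sum>i<m. a ! k * (cmod ((P *\<^sub>v v) $ i))\<^sup>2)"
      using bspec[OF P(2) v(1)] s by (simp only: of_real_eq_iff sum_distrib_left)
    also have "\<dots> \<le> (\<Sum>i<m. a ! i * (cmod ((P *\<^sub>v v) $ i))\<^sup>2)"
    proof (rule sum_mono)
      fix i assume "i \<in> {..<m}"
      thus "a ! k * (cmod ((P *\<^sub>v v) $ i))\<^sup>2 \<le> a ! i * (cmod ((P *\<^sub>v v) $ i))\<^sup>2"
        using P0[of i] desc[OF a(2), of i k] a(1) k
        by (cases "k < i") (auto intro!: mult_right_mono)
    qed
    also have "\<dots> \<le> (\<Sum>i<m. b ! i * (cmod ((Q *\<^sub>v v) $ i))\<^sup>2)"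
      using le[OF v(1)] unfolding bspec[OF P(3) v(1)] bspec[OF Q(3) v(1)] by (simp add: less_eq_complex_def)
    also have "\<dots> \<le> (\<Sum>i<m. b ! k * (cmod ((Q *\<^sub>v v) $ i))\<^sup>2)"
    proof (rule sum_mono)
      fix i assume "i \<in> {..<m}"
      thus "b ! i * (cmod ((Q *\<^sub>v v) $ i))\<^sup>2 \<le> b ! k * (cmod ((Q *\<^sub>v v) $ i))\<^sup>2"
        using Q0[of i] desc[OF b(2), of k i] b(1)
        by (cases "i < k") (auto intro!: mult_right_mono)
    qed
    also have "\<dots> = b ! k * s"
      using bspec[OF Q(2) v(1)] s by (simp only: of_real_eq_iff sum_distrib_left)
    finally have "a ! k \<le> b ! k" using \<open>s > 0\<close> by simp
    thus ?thesis
      unfolding eig j using nth_largest_mset_descending a(1,2) b(1,2) k by simp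
  qed
qed

section \<open>Comparison of the block matrix with its diagonal sum\<close>

text \<open>The form of \<open>H\<close> at \<open>(x, y)\<close> and its form at \<open>(y, -x)\<close> add up to the form of \<open>S \<oplus> S\<close> at
  \<open>(x, y)\<close>, because the two off-diagonal contributions cancel; and the second term is nonnegative.\<close>

lemma psd_block_form_le:
  fixes A B X :: "'a :: conjugatable_ordered_field mat"
  assumes A: "A \<in> carrier_mat n n" and B: "B \<in> carrier_mat n n" and X: "X \<in> carrier_mat n n"
    and psd: "psd_mat (four_block_mat A X X B)" and v: "v \<in> carrier_vec (n + n)"
  shows "(four_block_mat A X X B *\<^sub>v v) \<bullet>c v
    \<le> (four_block_mat (A + B) (0\<^sub>m n n) (0\<^sub>m n n) (A + B) *\<^sub>v v) \<bullet>c v"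
proof -
  define x where "x = vec_first v n"
  define y where "y = vec_last v n"
  have x: "x \<in> carrier_vec n" and y: "y \<in> carrier_vec n" unfolding x_def y_def by auto
  have vxy: "v = x @\<^sub>v y" unfolding x_def y_def using v by simp
  let ?H = "four_block_mat A X X B"
  let ?w = "y @\<^sub>v (- x)"
  have conj_append: "conjugate (p @\<^sub>v q) = conjugate p @\<^sub>v conjugate q" for p q :: "'a vec"
    by (rule eq_vecI) auto
  have form: "(four_block_mat C D D' E *\<^sub>v (p @\<^sub>v q)) \<bullet>c (p @\<^sub>v q)
      = (C *\<^sub>v p) \<bullet>c p + (D *\<^sub>v q) \<bullet>c p + ((D' *\<^sub>v p) \<bullet>c q + (E *\<^sub>v q) \<bullet>c q)"
    if "C \<in> carrier_mat n n" "D \<in> carrier_mat n n" "D' \<in> carrier_mat n n" "E \<in> carrier_mat n n"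
      "p \<in> carrier_vec n" "q \<in> carrier_vec n" for C D D' E :: "'a mat" and p q
    using that
    by (simp add: four_block_mat_mult_vec[of _ n n _ n _ n] conj_append
        scalar_prod_append[of _ n _ n] add_scalar_prod_distrib[of _ n])
  have neg: "(C *\<^sub>v (- x)) = - (C *\<^sub>v x)" if "C \<in> carrier_mat n n" for C
    using that x by (intro eq_vecI) auto
  have zero: "0\<^sub>m n n *\<^sub>v p = 0\<^sub>v n" if "p \<in> carrier_vec n" for p :: "'a vec"
    using that by (intro eq_vecI) auto
  have "0 \<le> (?H *\<^sub>v ?w) \<bullet>c ?w"
    using psd x y A B unfolding psd_mat_def by auto
  hence "(?H *\<^sub>v v) \<bullet>c v \<le> (?H *\<^sub>v v) \<bullet>c v + (?H *\<^sub>v ?w) \<bullet>c ?w"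
    by (metis add.right_neutral add_left_mono)
  also have "\<dots> = (four_block_mat (A + B) (0\<^sub>m n n) (0\<^sub>m n n) (A + B) *\<^sub>v v) \<bullet>c v"
    unfolding vxy using A B X x y
    by (simp add: form neg zero add_mult_distrib_mat_vec[of _ n n] add_scalar_prod_distrib[of _ n]
        uminus_conjugate_vec[symmetric])
  finally show ?thesis .
qed

lemma eig_complex_block_diagonal:
  assumes S: "S \<in> carrier_mat n n"
  shows "eig_complex (1 + 2 * k) (four_block_mat S (0\<^sub>m n n) (0\<^sub>m n n) S) = eig_complex (1 + k) S"
proof -
  have lin: "\<exists>es. char_poly S = (\<Prod>e\<leftarrow>es. [:- e, 1:])" using char_poly_factorized[OF S] by blast
  have nz: "char_poly S \<noteq> 0" using degree_monic_char_poly[OF S] by auto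
  have "char_poly (four_block_mat S (0\<^sub>m n n) (0\<^sub>m n n) S) = char_poly S * char_poly S"
    by (rule char_poly_0_block[OF refl lin lin S _ S]) auto
  thus ?thesis
    by (simp only: eig_complex_def proots_mult[OF nz nz] image_mset_union nth_largest_double)
qed

lemma eig_complex_psd_block:
  fixes A B X :: "complex mat"
  assumes A: "A \<in> carrier_mat n n" "hermitian_mat A" and B: "B \<in> carrier_mat n n" "hermitian_mat B"
    and X: "X \<in> carrier_mat n n" and psd: "psd_mat (four_block_mat A X X B)"
  shows "eig_complex (1 + 2 * k) (four_block_mat A X X B) \<le> eig_complex (1 + k) (A + B)"
proof -
  have S: "A + B \<in> carrier_mat n n" "hermitian_mat (A + B)"
    using A B hermitian_mat_add by auto
  have "eig_complex (1 + 2 * k) (four_block_mat A X X B)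
    \<le> eig_complex (1 + 2 * k) (four_block_mat (A + B) (0\<^sub>m n n) (0\<^sub>m n n) (A + B))"
    using A(1) B(1) psd psd_block_form_le[OF A(1) B(1) X psd] hermitian_block_diagonal[OF S]
    by (intro eig_complex_mono[of _ "n + n"]) (auto simp: psd_mat_def)
  thus ?thesis unfolding eig_complex_block_diagonal[OF S(1)] .
qed

section \<open>Passage from real to complex matrices\<close>

lemma hermitian_mat_complexify:
  assumes "hermitian_mat T" "T \<in> carrier_mat n n"
  shows "hermitian_mat (map_mat complex_of_real T)"
  using assms(2) hermitian_mat_index[OF assms] by (intro hermitian_matI[of _ n]) auto

text \<open>A real symmetric matrix has no nonreal eigenvalues, so its characteristic polynomial already
  splits over the reals, into the factors that it has over the complex numbers.\<close>

lemma eig_real_eq_eig_complex: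
  assumes T: "T \<in> carrier_mat n n" and herm: "hermitian_mat T"
  shows "eig_real j T = eig_complex j (map_mat complex_of_real T)"
proof -
  have T': "map_mat complex_of_real T \<in> carrier_mat n n" using T by simp
  obtain rs where rs: "char_poly (map_mat complex_of_real T) = (\<Prod>r\<leftarrow>rs. [:- complex_of_real r, 1:])"
    using hermitian_form_eigencoordinates[OF T' hermitian_mat_complexify[OF herm T]] by metis
  interpret of_real_hom: inj_idom_hom complex_of_real by unfold_locales auto
  interpret poly_hom: map_poly_inj_idom_hom complex_of_real ..
  have "map_poly complex_of_real (char_poly T)
      = map_poly complex_of_real (\<Prod>r\<leftarrow>rs. [:- r, 1:])"
    unfolding of_real_hom.char_poly_hom[OF T, symmetric] rs
    by (simp add: poly_hom.hom_prod_list comp_def)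
  hence "char_poly T = (\<Prod>r\<leftarrow>rs. [:- r, 1:])" by simp
  thus ?thesis
    unfolding eig_complex_linear_factors[OF rs] eig_real_def by (simp add: proots_linear_factors)
qed

text \<open>At \<open>v = x + \<i> y\<close> the complex form equals the sum of the real forms at \<open>x\<close> and \<open>y\<close>; the
  imaginary part vanishes because \<open>T\<close> is symmetric.\<close>

lemma psd_mat_complexify:
  fixes T :: "real mat"
  assumes psd: "psd_mat T" and T: "T \<in> carrier_mat n n"
  shows "psd_mat (map_mat complex_of_real T)"
  unfolding psd_mat_def
proof (intro conjI ballI)
  have herm: "hermitian_mat T" using psd by (simp add: psd_mat_def)
  thus "hermitian_mat (map_mat complex_of_real T)" using T by (rule hermitian_mat_complexify)
  fix v :: "complex vec" assume "v \<in> carrier_vec (dim_row (map_mat complex_of_real T))"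
  hence v: "v \<in> carrier_vec n" using T by simp
  define x where "x = map_vec Re v"
  define y where "y = map_vec Im v"
  have x: "x \<in> carrier_vec n" and y: "y \<in> carrier_vec n" using v by (auto simp: x_def y_def)
  have form: "(T *\<^sub>v u) \<bullet>c u = (\<Sum>i<n. \<Sum>j<n. T $$ (i, j) * u $ j * u $ i)" if "u \<in> carrier_vec n" for u
    using T that by (simp add: scalar_prod_def sum_distrib_right atLeast0LessThan)
  have cform: "(map_mat complex_of_real T *\<^sub>v v) \<bullet>c v
      = (\<Sum>i<n. \<Sum>j<n. complex_of_real (T $$ (i, j)) * v $ j * cnj (v $ i))"
    using T v by (simp add: scalar_prod_def sum_distrib_right atLeast0LessThan)
  have "Re ((map_mat complex_of_real T *\<^sub>v v) \<bullet>c v) = (T *\<^sub>v x) \<bullet>c x + (T *\<^sub>v y) \<bullet>c y"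
    unfolding cform form[OF x] form[OF y] using v
    by (simp add: x_def y_def distrib_left sum.distrib mult.assoc)
  also have "\<dots> \<ge> 0" using psd x y T by (simp add: psd_mat_def)
  finally have re: "Re ((map_mat complex_of_real T *\<^sub>v v) \<bullet>c v) \<ge> 0" .
  have "(\<Sum>i<n. \<Sum>j<n. T $$ (i, j) * Im (v $ j) * Re (v $ i))
      = (\<Sum>j<n. \<Sum>i<n. T $$ (i, j) * Im (v $ j) * Re (v $ i))"
    by (rule sum.swap)
  also have "\<dots> = (\<Sum>i<n. \<Sum>j<n. T $$ (i, j) * Re (v $ j) * Im (v $ i))"
    using hermitian_mat_index[OF herm T] by (intro sum.cong refl) (simp add: mult_ac)
  finally have im: "Im ((map_mat complex_of_real T *\<^sub>v v) \<bullet>c v) = 0"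
    unfolding cform by (simp add: distrib_left right_diff_distrib sum_subtractf sum_negf sum.distrib mult.assoc)
  from re im show "0 \<le> (map_mat complex_of_real T *\<^sub>v v) \<bullet>c v" by (simp add: less_eq_complex_def)
qed

lemma eig_real_psd_block:
  fixes A B X :: "real mat"
  assumes A: "A \<in> carrier_mat n n" "hermitian_mat A" and B: "B \<in> carrier_mat n n" "hermitian_mat B"
    and X: "X \<in> carrier_mat n n" and psd: "psd_mat (four_block_mat A X X B)"
  shows "eig_real (1 + 2 * k) (four_block_mat A X X B) \<le> eig_real (1 + k) (A + B)"
proof -
  let ?c = "map_mat complex_of_real"
  have H: "four_block_mat A X X B \<in> carrier_mat (n + n) (n + n)" using A B by auto
  have cH: "?c (four_block_mat A X X B) = four_block_mat (?c A) (?c X) (?c X) (?c B)"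
    by (rule map_four_block_mat[OF A(1) X X B(1)])
  have cS: "?c (A + B) = ?c A + ?c B" using A B by (intro eq_matI) auto
  have "eig_complex (1 + 2 * k) (four_block_mat (?c A) (?c X) (?c X) (?c B))
      \<le> eig_complex (1 + k) (?c A + ?c B)"
    using A B X psd_mat_complexify[OF psd H] unfolding cH
    by (intro eig_complex_psd_block[of _ n]) (auto intro: hermitian_mat_complexify)
  moreover have "hermitian_mat (four_block_mat A X X B)" using psd by (simp add: psd_mat_def)
  ultimately show ?thesis
    using eig_real_eq_eig_complex[OF H] A B hermitian_mat_add[OF A B]
    by (simp add: eig_real_eq_eig_complex[of _ n] cH cS)
qed

section \<open>The eigenvalue inequality\<close>

theorem corollary2p4:
  fixes n :: nat
  shows
    "(\<forall>(A :: complex mat) B X H.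
        A \<in> carrier_mat n n \<longrightarrow> B \<in> carrier_mat n n \<longrightarrow> X \<in> carrier_mat n n \<longrightarrow>
        hermitian_mat A \<longrightarrow> hermitian_mat B \<longrightarrow> hermitian_mat X \<longrightarrow>
        H = four_block_mat A X X B \<longrightarrow> psd_mat H \<longrightarrow>
        (\<forall>k<n. eig_complex (1 + 2 * k) H \<le> eig_complex (1 + k) (A + B)))
     \<and>
     (\<forall>(A :: real mat) B X H.
        A \<in> carrier_mat n n \<longrightarrow> B \<in> carrier_mat n n \<longrightarrow> X \<in> carrier_mat n n \<longrightarrow>
        hermitian_mat A \<longrightarrow> hermitian_mat B \<longrightarrow> hermitian_mat X \<longrightarrow>
        H = four_block_mat A X X B \<longrightarrow> psd_mat H \<longrightarrow>
        (\<forall>k<n. eig_real (1 + 2 * k) H \<le> eig_real (1 + k) (A + B)))"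
  using eig_complex_psd_block eig_real_psd_block by blast

end
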